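(* For $t\in[0,1]$, $$N(t)=\frac{e-1}{e}+e^{\,t-1+\frac{t}{e-1}}.$$
   Context: For real $t\ge 0$, $N(t)$ denotes the expected number of selections when numbers are selected independently and uniformly at random from $[1,e]$ until their product is greater than $e^t$. That is, $N(t)$ is the expected value of $\min\{n\ge 1: Z_1Z_2\cdots Z_n>e^t\}$, where $Z_1,Z_2,\ldots$ are i.i.d. uniform on $[1,e]$. *)

theory Defs
  imports "HOL-Probability.Probability"
begin

text \<open>
  The index of the first partial product \<open>z 1 * ... * z n\<close> (with \<open>n \<ge> 1\<close>) exceeding \<open>exp t\<close>.
  The infimum is taken in the extended naturals, so it is a minimum whenever some partial
  product exceeds \<open>exp t\<close>, and \<open>\<infinity>\<close> otherwise.
\<close>

definition num_selections :: "real \<Rightarrow> (nat \<Rightarrow> real) \<Rightarrow> enat" where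
  "num_selections t z = Inf {enat n |n. n \<ge> 1 \<and> (\<Prod>i=1..n. z i) > exp t}"

definition expected_selections :: "'a measure \<Rightarrow> (nat \<Rightarrow> 'a \<Rightarrow> real) \<Rightarrow> real \<Rightarrow> ennreal" where
  "expected_selections M Z t =
     (\<integral>\<^sup>+ \<omega>. ennreal_of_enat (num_selections t (\<lambda>i. Z i \<omega>)) \<partial>M)"

definition iid_uniform_1_e :: "'a measure \<Rightarrow> (nat \<Rightarrow> 'a \<Rightarrow> real) \<Rightarrow> bool" where
  "iid_uniform_1_e M Z \<longleftrightarrow>
     prob_space.indep_vars M (\<lambda>_. borel) Z {1..} \<and>
     (\<forall>n\<ge>1. distr M lborel (Z n) = uniform_measure lborel {1..exp 1})"

end

theory Submission imports Defs begin

text \<open>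
  Write \<open>P n\<close> for the product of the first \<open>n\<close> selections and \<open>c = 1 / (e - 1)\<close>. Since every
  factor is at least \<open>1\<close>, the partial products never decrease, so the waiting time exceeds \<open>n\<close>
  precisely when \<open>P n \<le> exp t\<close>, and \<open>N(t)\<close> is the sum of the probabilities of these events.

  As long as \<open>1 \<le> x \<le> e\<close>, the upper end of the range \<open>[1, e]\<close> is never felt: conditioning on one
  factor \<open>z\<close> turns the distribution function \<open>G n\<close> of \<open>P n\<close> into
  \<open>G (n + 1) x = c * (integral of G n (x / z) over 1 \<le> z \<le> x)\<close>. In the logarithmic
  variable \<open>s = ln x\<close>, the function \<open>exp (- s) * G n (exp s)\<close> starts as \<open>exp (- s)\<close> and is integrated
  from \<open>0\<close> and multiplied by \<open>c\<close> in each step. The \<open>n\<close>-fold integral \<open>R n\<close> of \<open>exp (- s)\<close> is, up to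
  sign, a Taylor remainder of the exponential function, and \<open>G n x = c ^ n * x * R n (ln x)\<close>
  (\<open>emeasure_prod_le\<close>).

  To sum the series, note that two consecutive remainders add up to one Taylor term:
  \<open>R n t + R (n + 1) t = t ^ n / fact n\<close>. Multiplying by \<open>c ^ n\<close> and summing gives a linear equation
  for \<open>S = (\<Sum>n. c ^ n * R n t)\<close>, namely \<open>S + (S - exp (- t)) / c = exp (c * t)\<close>, whose solution
  (\<open>sums_exp_remainder\<close>) yields the formula after multiplication by \<open>exp t\<close>.
\<close>

section \<open>Iterated integrals of the exponential function\<close>

text \<open>
  The \<open>n\<close>-fold integral from \<open>0\<close> of \<open>exp (- t)\<close>, that is
  \<open>(-1) ^ n * (exp (- t) - (\<Sum>k<n. (- t) ^ k / fact k))\<close>. The recursion through Taylor terms,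
  in place of integrals, is the identity that makes the series summable in closed form.
\<close>

primrec exp_remainder :: "nat \<Rightarrow> real \<Rightarrow> real" where
  "exp_remainder 0 = (\<lambda>t. exp (- t))"
| "exp_remainder (Suc n) = (\<lambda>t. t ^ n / fact n - exp_remainder n t)"

lemma exp_remainder_Suc_0 [simp]: "exp_remainder (Suc n) 0 = 0"
  by (induction n) auto

lemma has_real_derivative_exp_remainder_Suc:
  "(exp_remainder (Suc n) has_real_derivative exp_remainder n t) (at t)"
proof (induction n arbitrary: t)
  case 0
  have "((\<lambda>t. 1 - exp (- t)) has_real_derivative exp (- t)) (at t)"
    by (auto intro!: derivative_eq_intros)
  then show ?case by simp
next
  case (Suc n)
  have "((\<lambda>t. t ^ Suc n / fact (Suc n) - exp_remainder (Suc n) t)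
      has_real_derivative (t ^ n / fact n - exp_remainder n t)) (at t)"
    by (rule derivative_eq_intros Suc.IH refl | simp del: exp_remainder.simps fact_Suc)+
       (simp add: fact_Suc divide_simps)
  then show ?case by (simp only: exp_remainder.simps)
qed

lemma continuous_on_exp_remainder: "continuous_on A (exp_remainder n)"
proof (cases n)
  case 0
  then show ?thesis by (auto intro!: continuous_intros)
next
  case (Suc m)
  then show ?thesis
    using has_real_derivative_exp_remainder_Suc[of m]
    by (auto intro!: continuous_at_imp_continuous_on DERIV_isCont simp del: exp_remainder.simps)
qed

lemma measurable_exp_remainder [measurable]: "exp_remainder n \<in> borel_measurable borel"
  by (rule borel_measurable_continuous_onI[OF continuous_on_exp_remainder])

lemma exp_remainder_nonneg:
  assumes "t \<ge> 0"
  shows "exp_remainder n t \<ge> 0"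
  using assms
proof (induction n arbitrary: t)
  case (Suc n)
  have "exp_remainder (Suc n) 0 \<le> exp_remainder (Suc n) t"
  proof (rule DERIV_nonneg_imp_nondecreasing[OF Suc.prems])
    fix s :: real assume "0 \<le> s"
    then show "\<exists>y. (exp_remainder (Suc n) has_real_derivative y) (at s) \<and> 0 \<le> y"
      using has_real_derivative_exp_remainder_Suc[of n s] Suc.IH[of s] by blast
  qed
  then show ?case by (simp del: exp_remainder.simps)
qed simp

lemma exp_remainder_le:
  assumes "t \<ge> 0"
  shows "exp_remainder n t \<le> t ^ n / fact n"
  using exp_remainder_nonneg[OF assms, of "Suc n"] by simp

text \<open>
  The bound by the terms of the exponential series makes the series converge; the recursion then
  expresses the series of shifted terms through the same sum, which determines it.
\<close>

lemma sums_exp_remainder: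
  assumes "t \<ge> 0" and "c > 0"
  shows "(\<lambda>n. c ^ n * exp_remainder n t) sums ((c * exp (c * t) + exp (- t)) / (c + 1))"
proof -
  let ?f = "\<lambda>n. c ^ n * exp_remainder n t"
  have exp_sums: "(\<lambda>n. c ^ n * (t ^ n / fact n)) sums exp (c * t)"
    using exp_converges[of "c * t"]
    by (simp add: power_mult_distrib divide_inverse mult_ac scaleR_conv_of_real)
  have "summable ?f"
  proof (rule summable_comparison_test'[where N = 0])
    show "summable (\<lambda>n. c ^ n * (t ^ n / fact n))"
      using exp_sums by (rule sums_summable)
    show "norm (?f n) \<le> c ^ n * (t ^ n / fact n)" for n
    proof -
      have "norm (?f n) = ?f n"
        using exp_remainder_nonneg[OF assms(1), of n] assms(2) by simp
      also have "\<dots> \<le> c ^ n * (t ^ n / fact n)"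
        using exp_remainder_le[OF assms(1), of n] assms(2) by (intro mult_left_mono) auto
      finally show ?thesis .
    qed
  qed
  then have S: "?f sums suminf ?f" by (rule summable_sums)
  then have "(\<lambda>n. ?f (Suc n)) sums (suminf ?f - exp (- t))"
    by (subst sums_Suc_iff) simp
  then have "(\<lambda>n. ?f (Suc n) / c) sums ((suminf ?f - exp (- t)) / c)"
    by (rule sums_divide)
  with S have "(\<lambda>n. ?f n + ?f (Suc n) / c) sums (suminf ?f + (suminf ?f - exp (- t)) / c)"
    by (rule sums_add)
  moreover have "?f n + ?f (Suc n) / c = c ^ n * (t ^ n / fact n)" for n
    using assms(2) by (simp add: field_simps)
  ultimately have "suminf ?f + (suminf ?f - exp (- t)) / c = exp (c * t)"
    using exp_sums by (simp add: sums_unique2)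
  then have "suminf ?f = (c * exp (c * t) + exp (- t)) / (c + 1)"
    using assms(2) by (simp add: field_simps)
  with S show ?thesis by simp
qed

section \<open>The waiting time as a series of probabilities\<close>

lemma num_selections_eq_INF:
  "num_selections t z = (INF n. if n \<ge> 1 \<and> (\<Prod>i=1..n. z i) > exp t then enat n else \<infinity>)"
proof (rule antisym)
  show "num_selections t z \<le> (INF n. if n \<ge> 1 \<and> (\<Prod>i=1..n. z i) > exp t then enat n else \<infinity>)"
    unfolding num_selections_def by (intro INF_greatest) (auto intro!: Inf_lower)
  show "(INF n. if n \<ge> 1 \<and> (\<Prod>i=1..n. z i) > exp t then enat n else \<infinity>) \<le> num_selections t z"
    unfolding num_selections_def
  proof (rule Inf_greatest, safe)
    fix n assume "n \<ge> 1" "(\<Prod>i=1..n. z i) > exp t"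
    then show "(INF n. if n \<ge> 1 \<and> (\<Prod>i=1..n. z i) > exp t then enat n else \<infinity>) \<le> enat n"
      by (intro INF_lower2[of n]) auto
  qed
qed

lemma less_num_selections_iff:
  "enat n < num_selections t z \<longleftrightarrow> (\<forall>m\<in>{1..n}. (\<Prod>i=1..m. z i) \<le> exp t)"
proof -
  have "enat n < num_selections t z \<longleftrightarrow> enat (Suc n) \<le> num_selections t z"
    by (simp add: Suc_ile_eq)
  also have "\<dots> \<longleftrightarrow> (\<forall>m\<ge>1. (\<Prod>i=1..m. z i) > exp t \<longrightarrow> Suc n \<le> m)"
    unfolding num_selections_def le_Inf_iff by auto
  also have "\<dots> \<longleftrightarrow> (\<forall>m\<in>{1..n}. (\<Prod>i=1..m. z i) \<le> exp t)"
    by (metis atLeastAtMost_iff not_le Suc_le_eq)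
  finally show ?thesis .
qed

text \<open>
  For factors at least \<open>1\<close> the last partial product is the largest; the hypothesis \<open>t \<ge> 0\<close> covers
  \<open>n = 0\<close>, where the empty product does not exceed \<open>exp t\<close>.
\<close>

lemma less_num_selections_iff_prod_le:
  assumes "\<And>i. i \<ge> 1 \<Longrightarrow> z i \<ge> 1" and "t \<ge> 0"
  shows "enat n < num_selections t z \<longleftrightarrow> (\<Prod>i=1..n. z i) \<le> exp t"
proof -
  have mono: "(\<Prod>i=1..m. z i) \<le> (\<Prod>i=1..n. z i)" if "m \<le> n" for m
    using that assms(1) by (intro prod_mono2) (auto intro: order_trans[of 0 1])
  show ?thesis
    unfolding less_num_selections_iff using assms(2)
    by (cases "n = 0") (auto intro: order_trans[OF mono[simplified]])
qed

section \<open>Products of independent uniform variables\<close>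

text \<open>
  Condition on the uniform factor: independence makes the joint law a product measure, and Fubini's
  theorem integrates the distribution function of the other factor.
\<close>

lemma (in prob_space) emeasure_mult_uniform_le:
  fixes X Y :: "'a \<Rightarrow> real"
  assumes indep: "indep_var borel X borel Y"
    and unif: "distr M lborel X = uniform_measure lborel {a..b}" and "a \<le> b"
  shows "emeasure M {\<omega> \<in> space M. X \<omega> * Y \<omega> \<le> x} =
    (\<integral>\<^sup>+z. emeasure M {\<omega> \<in> space M. z * Y \<omega> \<le> x} * indicator {a..b} z \<partial>lborel) / ennreal (b - a)"
proof -
  have X [measurable]: "X \<in> borel_measurable M" and Y [measurable]: "Y \<in> borel_measurable M"
    using indep by (auto dest: indep_var_rv1 indep_var_rv2)
  let ?A = "{p. fst p * snd p \<le> x} :: (real \<times> real) set"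
  let ?f = "\<lambda>z. emeasure (distr M borel Y) (Pair z -` ?A)"
  interpret Y: prob_space "distr M borel Y"
    by (rule prob_space_distr) simp
  have "{p \<in> space (borel \<Otimes>\<^sub>M borel). fst p * snd p \<le> x} \<in> sets (borel \<Otimes>\<^sub>M borel)"
    by measurable
  then have A: "?A \<in> sets (borel \<Otimes>\<^sub>M borel)"
    by (simp add: space_pair_measure)
  have sets_eq: "sets (distr M borel X \<Otimes>\<^sub>M distr M borel Y) = sets (borel \<Otimes>\<^sub>M borel)"
    by (intro sets_pair_measure_cong) auto
  have f: "?f \<in> borel_measurable lborel"
  proof -
    have "?A \<in> sets (borel \<Otimes>\<^sub>M distr M borel Y)"
      using A sets_pair_measure_cong[of borel borel "distr M borel Y" borel] by simp
    then show ?thesis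
      using Y.measurable_emeasure_Pair[of ?A borel] by simp
  qed
  have f_eq: "?f z = emeasure M {\<omega> \<in> space M. z * Y \<omega> \<le> x}" for z
    by (subst emeasure_distr) (auto intro!: arg_cong[where f = "emeasure M"])
  have "emeasure M {\<omega> \<in> space M. X \<omega> * Y \<omega> \<le> x} =
      emeasure (distr M (borel \<Otimes>\<^sub>M borel) (\<lambda>\<omega>. (X \<omega>, Y \<omega>))) ?A"
    by (subst emeasure_distr[OF _ A]) (auto intro!: arg_cong[where f = "emeasure M"])
  also have "\<dots> = emeasure (distr M borel X \<Otimes>\<^sub>M distr M borel Y) ?A"
    using indep by (simp add: indep_var_distribution_eq)
  also have "\<dots> = (\<integral>\<^sup>+z. ?f z \<partial>distr M borel X)"
    using A by (intro Y.emeasure_pair_measure_alt) (simp add: sets_eq)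
  also have "distr M borel X = distr M lborel X"
    by (rule distr_cong) auto
  also have "(\<integral>\<^sup>+z. ?f z \<partial>\<dots>) = (\<integral>\<^sup>+z. ?f z * indicator {a..b} z \<partial>lborel) / emeasure lborel {a..b}"
    unfolding unif using f by (rule nn_integral_uniform_measure) simp
  finally show ?thesis
    using \<open>a \<le> b\<close> unfolding f_eq by simp
qed

text \<open>
  For \<open>k = c ^ n\<close>, and up to the density \<open>c\<close> of one factor, this is the step from \<open>n\<close> to \<open>n + 1\<close>
  in the distribution functions: the substitution \<open>s = ln (x / z)\<close> turns the integral over \<open>z\<close>
  into \<open>k * x\<close> times the integral of \<open>exp_remainder n\<close> over \<open>[0, ln x]\<close>.
\<close>

lemma nn_integral_exp_remainder_ln:
  assumes "x \<ge> 1" and "k \<ge> 0"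
  shows "(\<integral>\<^sup>+z. ennreal (k * (x / z) * exp_remainder n (ln (x / z))) * indicator {1..x} z \<partial>lborel) =
    ennreal (k * x * exp_remainder (Suc n) (ln x))"
proof -
  let ?F = "\<lambda>z. - (k * x * exp_remainder (Suc n) (ln x - ln z))"
  have "(\<integral>\<^sup>+z. ennreal (k * (x / z) * exp_remainder n (ln (x / z))) * indicator {1..x} z \<partial>lborel) =
      ennreal (?F x - ?F 1)"
  proof (rule nn_integral_FTC_Icc)
    show "(\<lambda>z. k * (x / z) * exp_remainder n (ln (x / z))) \<in> borel_measurable borel"
      by measurable
    show "(?F has_real_derivative k * (x / z) * exp_remainder n (ln (x / z))) (at z)"
      if "z \<in> {1..x}" for z
    proof -
      have "((\<lambda>z. exp_remainder (Suc n) (ln x - ln z)) has_real_derivative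
          exp_remainder n (ln x - ln z) * (- (1 / z))) (at z)"
        by (rule DERIV_chain2[OF has_real_derivative_exp_remainder_Suc])
           (use that in \<open>auto intro!: derivative_eq_intros simp: divide_simps\<close>)
      then have "(?F has_real_derivative
          - (k * x * (exp_remainder n (ln x - ln z) * (- (1 / z))))) (at z)"
        by (intro DERIV_minus DERIV_cmult)
      then show ?thesis
        using that by (simp add: ln_div mult_ac del: exp_remainder.simps)
    qed
    show "0 \<le> k * (x / z) * exp_remainder n (ln (x / z))" if "z \<in> {1..x}" for z
      using that assms by (intro mult_nonneg_nonneg exp_remainder_nonneg) auto
  qed (use assms in auto)
  also have "?F x - ?F 1 = k * x * exp_remainder (Suc n) (ln x)"
    by (simp del: exp_remainder.simps)
  finally show ?thesis .
qed

locale uniform_1_e_selections = prob_space M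
  for M :: "'a measure" and Z :: "nat \<Rightarrow> 'a \<Rightarrow> real" +
  assumes iid: "iid_uniform_1_e M Z"
begin

lemma indep: "indep_vars (\<lambda>_. borel) Z {1..}"
  using iid by (simp add: iid_uniform_1_e_def)

lemma distr_Z: "n \<ge> 1 \<Longrightarrow> distr M lborel (Z n) = uniform_measure lborel {1..exp 1}"
  using iid by (simp add: iid_uniform_1_e_def)

lemma measurable_Z: "n \<ge> 1 \<Longrightarrow> Z n \<in> borel_measurable M"
  using indep by (simp add: indep_vars_def)

lemma measurable_prod_Z [measurable]: "(\<lambda>\<omega>. \<Prod>i=1..n. Z i \<omega>) \<in> borel_measurable M"
  by (intro borel_measurable_prod measurable_Z) simp

lemma measurable_num_selections:
  "(\<lambda>\<omega>. num_selections t (\<lambda>i. Z i \<omega>)) \<in> measurable M (count_space UNIV)"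
  unfolding num_selections_eq_INF by measurable

lemma AE_Z_ge_1: "AE \<omega> in M. \<forall>i\<ge>1. Z i \<omega> \<ge> 1"
proof -
  have "AE \<omega> in M. i \<ge> 1 \<longrightarrow> Z i \<omega> \<ge> 1" for i
  proof (cases "i \<ge> 1")
    case True
    have "AE x in distr M lborel (Z i). x \<ge> 1"
      unfolding distr_Z[OF True] by (rule AE_uniform_measureI) auto
    then have "AE \<omega> in M. Z i \<omega> \<ge> 1"
      using measurable_Z[OF True] by (subst (asm) AE_distr_iff) auto
    then show ?thesis by simp
  qed simp
  then show ?thesis by (simp add: AE_all_countable)
qed

lemma emeasure_prod_le_0:
  assumes "x < 1"
  shows "emeasure M {\<omega> \<in> space M. (\<Prod>i=1..n. Z i \<omega>) \<le> x} = 0"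
proof -
  have "AE \<omega> in M. \<not> (\<Prod>i=1..n. Z i \<omega>) \<le> x"
    using AE_Z_ge_1
  proof eventually_elim
    case (elim \<omega>)
    then have "(\<Prod>i=1..n. Z i \<omega>) \<ge> 1" by (intro prod_ge_1) auto
    with assms show ?case by simp
  qed
  then show ?thesis
    by (subst emeasure_eq_0_AE) auto
qed

text \<open>
  For \<open>x \<le> e\<close> the conditional probability given the new factor \<open>z\<close> vanishes beyond \<open>z = x\<close>, so the
  constraint \<open>z \<le> e\<close> never cuts off the integral; this is why one formula holds on all of \<open>[1, e]\<close>.
\<close>

lemma emeasure_prod_le:
  assumes "x \<in> {1..exp 1}"
  shows "emeasure M {\<omega> \<in> space M. (\<Prod>i=1..n. Z i \<omega>) \<le> x} =
    ennreal ((1 / (exp 1 - 1)) ^ n * x * exp_remainder n (ln x))"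
  using assms
proof (induction n arbitrary: x)
  case 0
  then have "(1 / (exp 1 - 1)) ^ 0 * x * exp_remainder 0 (ln x) = 1"
    by (simp add: exp_minus)
  with 0 show ?case by (simp add: emeasure_space_1 del: power_0)
next
  case (Suc n)
  let ?c = "1 / (exp 1 - 1 :: real)"
  let ?P = "\<lambda>\<omega>. \<Prod>i=1..n. Z i \<omega>"
  have c: "?c > 0" by simp
  have "indep_vars (\<lambda>_. borel) Z (insert (Suc n) {1..n})"
    by (rule indep_vars_subset[OF indep]) auto
  then have ind: "indep_var borel (Z (Suc n)) borel ?P"
    by (intro indep_vars_prod) auto
  have cond: "emeasure M {\<omega> \<in> space M. z * ?P \<omega> \<le> x} * indicator {1..exp 1} z =
      ennreal (?c ^ n * (x / z) * exp_remainder n (ln (x / z))) * indicator {1..x} z" for z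
  proof (cases "z \<ge> 1")
    case True
    then have "emeasure M {\<omega> \<in> space M. z * ?P \<omega> \<le> x} =
        emeasure M {\<omega> \<in> space M. ?P \<omega> \<le> x / z}"
      by (intro arg_cong[where f = "emeasure M"] Collect_cong) (auto simp: field_simps)
    also have "\<dots> = (if z \<le> x
        then ennreal (?c ^ n * (x / z) * exp_remainder n (ln (x / z))) else 0)"
    proof (cases "z \<le> x")
      case le: True
      have "x \<le> exp 1" using Suc.prems by simp
      also have "exp 1 * 1 \<le> exp 1 * z" using True by (intro mult_left_mono) auto
      then have "exp 1 \<le> exp 1 * z" by (simp only: mult_1_right)
      finally have "x \<le> exp 1 * z" .
      then have "x / z \<in> {1..exp 1}"
        using le True by (auto simp: divide_simps)
      with le show ?thesis by (simp only: Suc.IH if_True)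
    next
      case False
      then show ?thesis using True by (subst emeasure_prod_le_0) auto
    qed
    finally show ?thesis
      using Suc.prems True by (auto simp: indicator_def)
  qed (auto simp: indicator_def)
  have "emeasure M {\<omega> \<in> space M. (\<Prod>i=1..Suc n. Z i \<omega>) \<le> x} =
      emeasure M {\<omega> \<in> space M. Z (Suc n) \<omega> * ?P \<omega> \<le> x}"
    by (simp add: mult.commute)
  also have "\<dots> = (\<integral>\<^sup>+z. ennreal (?c ^ n * (x / z) * exp_remainder n (ln (x / z))) *
      indicator {1..x} z \<partial>lborel) / ennreal (exp 1 - 1)"
    unfolding cond[symmetric] by (rule emeasure_mult_uniform_le[OF ind distr_Z]) simp_all
  also have "\<dots> = ennreal (?c ^ n * x * exp_remainder (Suc n) (ln x)) / ennreal (exp 1 - 1)"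
    using Suc.prems by (subst nn_integral_exp_remainder_ln) simp_all
  also have "\<dots> = ennreal (?c ^ Suc n * x * exp_remainder (Suc n) (ln x))"
    using Suc.prems exp_remainder_nonneg[of "ln x" "Suc n"]
    by (subst divide_ennreal) (auto simp del: exp_remainder.simps)
  finally show ?case .
qed

lemma expected_selections_eq:
  assumes "t \<in> {0..1}"
  shows "expected_selections M Z t =
    ennreal ((exp 1 - 1) / exp 1 + exp (t - 1 + t / (exp 1 - 1)))"
proof -
  let ?c = "1 / (exp 1 - 1 :: real)"
  have t: "t \<ge> 0" and c: "?c > 0" using assms by auto
  have "expected_selections M Z t =
      (\<Sum>n. emeasure M {\<omega> \<in> space M. enat n < num_selections t (\<lambda>i. Z i \<omega>)})"
    unfolding expected_selections_def
    by (rule nn_integral_enat_function[OF measurable_num_selections])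
  also have "\<dots> = (\<Sum>n. emeasure M {\<omega> \<in> space M. (\<Prod>i=1..n. Z i \<omega>) \<le> exp t})"
  proof (intro suminf_cong emeasure_eq_AE)
    show "AE \<omega> in M. \<omega> \<in> {\<omega> \<in> space M. enat n < num_selections t (\<lambda>i. Z i \<omega>)} \<longleftrightarrow>
        \<omega> \<in> {\<omega> \<in> space M. (\<Prod>i=1..n. Z i \<omega>) \<le> exp t}" for n
      using AE_Z_ge_1 by eventually_elim (use t in \<open>simp add: less_num_selections_iff_prod_le\<close>)
  qed (use measurable_num_selections in measurable)
  also have "\<dots> = (\<Sum>n. ennreal (exp t * (?c ^ n * exp_remainder n t)))"
    using assms by (subst emeasure_prod_le) (simp_all add: mult_ac)
  also have "\<dots> = ennreal (exp t * ((?c * exp (?c * t) + exp (- t)) / (?c + 1)))"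
    using t c
    by (intro suminf_ennreal_eq sums_mult sums_exp_remainder)
       (auto intro!: mult_nonneg_nonneg zero_le_power exp_remainder_nonneg)
  also have "exp t * ((?c * exp (?c * t) + exp (- t)) / (?c + 1)) =
      (exp 1 - 1) / exp 1 + exp (t - 1 + t / (exp 1 - 1))"
  proof -
    \<comment> \<open>Here \<open>?c + 1 = e / (e - 1)\<close>, hence \<open>?c / (?c + 1) = 1 / e\<close>.\<close>
    have ne: "exp 1 - 1 \<noteq> (0 :: real)" by simp
    have "(?c * u + v) / (?c + 1) = u / exp 1 + v * ((exp 1 - 1) / exp 1)" for u v :: real
      using ne by (simp add: divide_simps)
    then show ?thesis
      by (simp add: distrib_left exp_add exp_diff exp_minus)
  qed
  finally show ?thesis .
qed

end

theorem theorem4: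
  fixes M :: "'a measure" and Z :: "nat \<Rightarrow> 'a \<Rightarrow> real" and t :: real
  assumes "prob_space M"
    and "iid_uniform_1_e M Z"
    and "t \<in> {0..1}"
  shows "expected_selections M Z t =
    ennreal ((exp 1 - 1) / exp 1 + exp (t - 1 + t / (exp 1 - 1)))"
proof -
  interpret uniform_1_e_selections M Z
    using assms(1,2)
    by (intro uniform_1_e_selections.intro uniform_1_e_selections_axioms.intro)
  show ?thesis
    using assms(3) by (rule expected_selections_eq)
qed

end
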